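(* Consider an instance of the problem $1|pmtn; r_j, p_j|F(C_j)$ with integer release times $r_j$, integer processing times $p_j$, and an objective function $F$ that is an increasing function of the completion times. Then in an optimal schedule every job-part is entirely assigned to one time interval; that is, for every job $j$ and every $k\in\{1,\dots,p_j\}$ there is a $t\in\{1,\dots,T\}$ such that the job-part $j.k$ is processed entirely in the time interval $(t-1,t]$.
   Context: The problem $1|pmtn; r_j, p_j|F(C_j)$: there are $n$ jobs $1,\dots,n$ to be processed on a single machine, which can process at most one job at each point in time. Job $j$ has an integer release time $r_j\ge 0$ and a positive integer processing time $p_j$. Job $j$ becomes available for processing at the moment $r_j$ (it cannot be processed before time $r_j$) and must be processed for a total time of $p_j$. Preemptions of one job in favor of another are allowed at any (real) time and any (finite) number of times. A schedule specifies which job is processed when: job $j$ is processed on a finite union of intervals of the form $(a,b]$ of real time, and the sets for different jobs are disjoint. It is feasible if no job is processed before its release time and each job $j$ is processed for exactly $p_j$ time. The completion time $C_j$ of job $j$ is the earliest point in time at which it has been processed for $p_j$ time. The objective $F=F(C_1,\dots,C_n)$ is increasing in the completion times: if $C_j\le C_j'$ for all $j$ with strict inequality for at least one $j$, then $F(C_1,\dots,C_n)<F(C_1',\dots,C_n')$. A schedule is optimal if it is feasible and minimizes $F$ among all feasible schedules. Standing assumption: optimal schedules contain no idle time, i.e. with $T=\sum_{j=1}^n p_j$ (the time horizon) and time measured from the start of processing, the machine is busy throughout $(0,T]$. Job-parts and time intervals: each job $j$ is separated into $p_j$ job-parts $j.1, j.2,\dots,j.p_j$ of unit length, in the order in which they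 are processed ($j.k$ is the $k$-th unit of processing of job $j$), and time is separated into the time intervals $1,2,\dots,T$, where $t$ stands for the time interval $(t-1,t]$. *)

theory Defs
  imports "HOL-Analysis.Analysis"
begin

text \<open>
  The finite type \<open>'j\<close> is the set of jobs. A schedule \<open>S\<close> maps each job to the set of
  points in time at which it is processed. In accordance with the use of intervals
  \<open>(a, b]\<close>, the point \<open>b\<close> stands for the time immediately up to and including \<open>b\<close>.
\<close>

type_synonym 'j schedule = "'j \<Rightarrow> real set"

definition finite_interval_union :: "real set \<Rightarrow> bool" where
  "finite_interval_union A \<longleftrightarrow>
     (\<exists>I :: (real \<times> real) set. finite I \<and> A = (\<Union>(a, b)\<in>I. {a<..b}))"

definition is_schedule :: "'j schedule \<Rightarrow> bool" where
  "is_schedule S \<longleftrightarrow> (\<forall>j. finite_interval_union (S j)) \<and> disjoint_family S"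

definition processed :: "'j schedule \<Rightarrow> 'j \<Rightarrow> real \<Rightarrow> real" where
  "processed S j x = measure lborel (S j \<inter> {..x})"

definition feasible :: "('j \<Rightarrow> nat) \<Rightarrow> ('j \<Rightarrow> nat) \<Rightarrow> 'j schedule \<Rightarrow> bool" where
  "feasible r p S \<longleftrightarrow> is_schedule S \<and>
     (\<forall>j. S j \<subseteq> {real (r j)..}) \<and>
     (\<forall>j. measure lborel (S j) = real (p j))"

definition completion_time :: "('j \<Rightarrow> nat) \<Rightarrow> 'j schedule \<Rightarrow> 'j \<Rightarrow> real" where
  "completion_time p S j = (LEAST x. processed S j x = real (p j))"

text \<open>
  The order on \<open>'j \<Rightarrow> real\<close> is pointwise: \<open>C < C'\<close> holds iff \<open>C j \<le> C' j\<close> for all \<open>j\<close>,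
  with strict inequality for at least one \<open>j\<close>. Completion times are always positive, so
  that nothing is required of \<open>F\<close> elsewhere (think of the sum of the squares of the
  completion times).
\<close>

definition increasing_objective :: "(('j \<Rightarrow> real) \<Rightarrow> real) \<Rightarrow> bool" where
  "increasing_objective F \<longleftrightarrow> strict_mono_on {C. \<forall>j. 0 < C j} F"

definition optimal ::
  "('j \<Rightarrow> nat) \<Rightarrow> ('j \<Rightarrow> nat) \<Rightarrow> (('j \<Rightarrow> real) \<Rightarrow> real) \<Rightarrow> 'j schedule \<Rightarrow> bool" where
  "optimal r p F S \<longleftrightarrow> feasible r p S \<and>
     (\<forall>S'. feasible r p S' \<longrightarrow> F (completion_time p S) \<le> F (completion_time p S'))"

definition horizon :: "('j::finite \<Rightarrow> nat) \<Rightarrow> nat" where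
  "horizon p = (\<Sum>j\<in>UNIV. p j)"

text \<open>Time is measured from the start of processing, i.e. processing starts at time 0.\<close>

definition no_idle_time :: "('j::finite \<Rightarrow> nat) \<Rightarrow> 'j schedule \<Rightarrow> bool" where
  "no_idle_time p S \<longleftrightarrow> {0<..real (horizon p)} \<subseteq> (\<Union>j. S j)"

text \<open>
  The \<open>k\<close>-th unit of processing of job \<open>j\<close> (counting from \<open>k = 1\<close>), as the set of points
  in time at which it is processed.
\<close>

definition job_part :: "'j schedule \<Rightarrow> 'j \<Rightarrow> nat \<Rightarrow> real set" where
  "job_part S j k = {x \<in> S j. real k - 1 < processed S j x \<and> processed S j x \<le> real k}"

definition time_interval :: "nat \<Rightarrow> real set" where
  "time_interval t = {real t - 1<..real t}"

end

theory Submission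
  imports Defs
begin

text \<open>
  An optimal schedule follows a strict priority rule: the jobs are ranked by their completion
  times, and a job is never processed while a job that completes earlier is available and
  unfinished. Otherwise a short piece of the lower-ranked job could be exchanged with the last
  piece of the higher-ranked one; this lowers the completion time of the latter and changes no
  other, so that it lowers \<open>F\<close> (\<open>exchange_improves\<close>, \<open>optimal_priority\<close>).

  Under a priority rule with integer release times, everything happens at integer times.
  Strictly between \<open>t\<close> and \<open>t + 1\<close> no job is released, so the top-ranked job that is available and
  unfinished at time \<open>t\<close> runs until it completes or time \<open>t + 1\<close> is reached. If all jobs have received an integer amount of
  processing by time \<open>t\<close>, that job still needs at least one unit and fills the whole interval
  (\<open>unit_interval_single_job\<close>), whence all amounts are again integers at time \<open>t + 1\<close>. By
  induction every unit interval up to the horizon belongs to a single job. The amount of processing that a job has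
  received then reaches an integer value only at the end of a unit interval, so that each
  job-part is one such interval.
\<close>

section \<open>Finite unions of half-open intervals\<close>

lemma finite_interval_union_Ioc: "finite_interval_union {a<..b}"
  unfolding finite_interval_union_def by (rule exI[of _ "{(a, b)}"]) auto

lemma finite_interval_union_Un:
  assumes "finite_interval_union A" "finite_interval_union B"
  shows "finite_interval_union (A \<union> B)"
proof -
  obtain I J where "finite I" "A = (\<Union>(a, b)\<in>I. {a<..b})" "finite J" "B = (\<Union>(a, b)\<in>J. {a<..b})"
    using assms unfolding finite_interval_union_def by blast
  then show ?thesis
    unfolding finite_interval_union_def by (intro exI[of _ "I \<union> J"]) auto
qed

lemma finite_interval_union_Diff_Ioc:
  assumes "finite_interval_union A" "c < d"
  shows "finite_interval_union (A - {c<..d})"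
proof -
  obtain I where I: "finite I" "A = (\<Union>(a, b)\<in>I. {a<..b})"
    using assms(1) unfolding finite_interval_union_def by blast
  let ?J = "(\<lambda>(a, b). (a, min b c)) ` I \<union> (\<lambda>(a, b). (max a d, b)) ` I"
  have "{a<..b} - {c<..d} = {a<..min b c} \<union> {max a d<..b}" for a b
    using assms(2) by auto
  then have "A - {c<..d} = (\<Union>(a, b)\<in>?J. {a<..b})"
    unfolding I(2) by (simp add: UN_Un UN_extend_simps split_beta UN_Un_distrib)
  with I(1) show ?thesis
    unfolding finite_interval_union_def by (intro exI[of _ ?J]) simp
qed

lemma finite_interval_union_fmeasurable:
  assumes "finite_interval_union A"
  shows "A \<in> fmeasurable lborel"
proof -
  obtain I where I: "finite I" "A = (\<Union>(a, b)\<in>I. {a<..b})"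
    using assms unfolding finite_interval_union_def by blast
  have "{a<..b} \<in> fmeasurable lborel" for a b :: real
    by (cases "a \<le> b") (auto simp: fmeasurable_def)
  then show ?thesis
    unfolding I(2) using I(1) by (intro fmeasurable.finite_UN) auto
qed

lemma finite_interval_union_left_nhd:
  assumes "finite_interval_union A" "x \<in> A"
  obtains d where "0 < d" "{x - d<..x} \<subseteq> A"
proof -
  obtain I where I: "finite I" "A = (\<Union>(a, b)\<in>I. {a<..b})"
    using assms(1) unfolding finite_interval_union_def by blast
  then obtain a b where "(a, b) \<in> I" "a < x" "x \<le> b"
    using assms(2) by auto
  then have "{x - (x - a)<..x} \<subseteq> A"
    unfolding I(2) by (auto intro!: bexI[of _ "(a, b)"])
  then show ?thesis using that \<open>a < x\<close> by (metis diff_gt_0_iff_gt)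
qed

lemma finite_interval_union_has_max:
  assumes "finite_interval_union A" "A \<noteq> {}"
  obtains c where "c \<in> A" "A \<subseteq> {..c}"
proof -
  obtain I where I: "finite I" "A = (\<Union>(a, b)\<in>I. {a<..b})"
    using assms(1) unfolding finite_interval_union_def by blast
  let ?B = "snd ` {(a, b) \<in> I. a < b}"
  have fin: "finite ?B"
    using I(1) by (intro finite_imageI finite_subset[OF _ I(1)]) auto
  have le: "\<exists>b\<in>?B. x \<le> b" if "x \<in> A" for x
    using that unfolding I(2) by force
  have "?B \<noteq> {}"
    using le assms(2) by blast
  then have "Max ?B \<in> ?B"
    using fin by (rule Max_in[rotated])
  then have "Max ?B \<in> A"
    unfolding I(2) by force
  moreover have "A \<subseteq> {..Max ?B}"
    using le Max_ge[OF fin] by (meson atMost_iff order_trans subsetI)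
  ultimately show ?thesis using that by blast
qed

section \<open>Processing and completion times in feasible schedules\<close>

lemma feasible_finite_interval_union:
  "feasible r p S \<Longrightarrow> finite_interval_union (S j)"
  by (simp add: feasible_def is_schedule_def)

lemma feasible_fmeasurable: "feasible r p S \<Longrightarrow> S j \<in> fmeasurable lborel"
  by (intro finite_interval_union_fmeasurable feasible_finite_interval_union)

lemma feasible_disjoint:
  "feasible r p S \<Longrightarrow> x \<in> S i \<Longrightarrow> x \<in> S j \<Longrightarrow> i = j"
  unfolding feasible_def is_schedule_def disjoint_family_on_def by blast

text \<open>Sharper than feasibility says, since the processing sets consist of intervals that are
  open on the left.\<close>

lemma feasible_after_release:
  assumes "feasible r p S" "x \<in> S j"
  shows "real (r j) < x"
proof -
  obtain d where "0 < d" "{x - d<..x} \<subseteq> S j"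
    using finite_interval_union_left_nhd feasible_finite_interval_union assms by metis
  moreover have "S j \<subseteq> {real (r j)..}"
    using assms(1) by (simp add: feasible_def)
  ultimately have "x - d / 2 \<in> {real (r j)..}"
    by (auto simp: subset_iff)
  then show ?thesis using \<open>0 < d\<close> by simp
qed

lemma processed_add:
  assumes "feasible r p S" "x \<le> y"
  shows "processed S j y = processed S j x + measure lborel (S j \<inter> {x<..y})"
proof -
  have "S j \<inter> {..y} = S j \<inter> {..x} \<union> S j \<inter> {x<..y}"
    using assms(2) by auto
  moreover have "measure lborel \<dots> =
      measure lborel (S j \<inter> {..x}) + measure lborel (S j \<inter> {x<..y})"
    using fmeasurable_Int_fmeasurable[OF feasible_fmeasurable[OF assms(1), of j]]
    by (intro measure_Union fmeasurableD) (auto simp: fmeasurableD2)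
  ultimately show ?thesis
    by (simp add: processed_def)
qed

lemma processed_mono: "feasible r p S \<Longrightarrow> x \<le> y \<Longrightarrow> processed S j x \<le> processed S j y"
  by (simp add: processed_add)

lemma processed_while_running:
  assumes "feasible r p S" "x \<le> y" "{x<..y} \<subseteq> S j"
  shows "processed S j y = processed S j x + (y - x)"
proof -
  have "S j \<inter> {x<..y} = {x<..y}"
    using assms(3) by auto
  then show ?thesis
    using processed_add[OF assms(1,2), of j] assms(2) by simp
qed

lemma completion_time_eqI:
  assumes "feasible r p S" "c \<in> S j" "S j \<subseteq> {..c}"
  shows "completion_time p S j = c"
  unfolding completion_time_def
proof (rule Least_equality)
  have "S j \<inter> {..c} = S j"
    using assms(3) by auto
  then show completed: "processed S j c = real (p j)"
    using assms(1) by (simp add: processed_def feasible_def)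
  show "c \<le> x" if x: "processed S j x = real (p j)" for x
  proof (rule ccontr)
    assume "\<not> c \<le> x"
    obtain d where d: "0 < d" "{c - d<..c} \<subseteq> S j"
      using finite_interval_union_left_nhd feasible_finite_interval_union assms by metis
    let ?y = "max x (c - d)"
    have "processed S j c = processed S j ?y + (c - ?y)"
      using d \<open>\<not> c \<le> x\<close> by (intro processed_while_running[OF assms(1)]) auto
    moreover have "processed S j x \<le> processed S j ?y"
      by (intro processed_mono[OF assms(1)]) simp
    ultimately show False
      using completed x d(1) \<open>\<not> c \<le> x\<close> by simp
  qed
qed

lemma completion_time_max:
  assumes "feasible r p S" "0 < p j"
  shows completion_time_in: "completion_time p S j \<in> S j"
    and completion_time_upper: "S j \<subseteq> {..completion_time p S j}"
proof -
  have "S j \<noteq> {}"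
    using assms by (auto simp: feasible_def dest!: spec[of _ j])
  then obtain c where "c \<in> S j" "S j \<subseteq> {..c}"
    using finite_interval_union_has_max feasible_finite_interval_union assms(1) by metis
  then show "completion_time p S j \<in> S j" "S j \<subseteq> {..completion_time p S j}"
    using completion_time_eqI[OF assms(1)] by metis+
qed

lemma processed_at_completion:
  assumes "feasible r p S" "0 < p j"
  shows "processed S j (completion_time p S j) = real (p j)"
proof -
  have "S j \<inter> {..completion_time p S j} = S j"
    using completion_time_upper[OF assms] by auto
  then show ?thesis
    using assms(1) by (simp add: processed_def feasible_def)
qed

section \<open>The exchange argument\<close>

lemma measure_exchange:
  assumes "A \<in> fmeasurable M" "B \<in> fmeasurable M" "D \<in> fmeasurable M"
    and "B \<subseteq> A" "D \<inter> A = {}" "measure M B = measure M D"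
  shows "measure M (A - B \<union> D) = measure M A"
proof -
  have "measure M (A - B \<union> D) = measure M (A - B) + measure M D"
    using assms by (intro measure_Union) (auto simp: fmeasurableD fmeasurableD2 fmeasurable_Diff)
  also have "measure M (A - B) = measure M A - measure M B"
    using assms by (intro measurable_measure_Diff) auto
  finally show ?thesis
    using assms(6) by simp
qed

text \<open>
  If job \<open>i\<close> runs at a time \<open>x\<close> at which \<open>j\<close> is available and unfinished although \<open>j\<close> completes
  before \<open>i\<close>, a piece of \<open>i\<close> that ends at \<open>x\<close> is exchanged with the last piece of \<open>j\<close>. Job \<open>i\<close> is
  released before \<open>x\<close> and only gets time before its own completion, so that its completion time
  stays the same, while \<open>j\<close> loses its last moments.
\<close>

lemma exchange_improves:
  assumes feas: "feasible r p S" and pos: "\<forall>j. 0 < p j"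
    and x: "x \<in> S i" "real (r j) < x" "x < completion_time p S j"
    and less: "completion_time p S j < completion_time p S i"
  obtains S' where "feasible r p S'" "completion_time p S' < completion_time p S"
proof -
  let ?C = "completion_time p S"
  have C_in: "?C k \<in> S k" and C_upper: "S k \<subseteq> {..?C k}" for k
    using completion_time_max[OF feas] pos by blast+
  have "i \<noteq> j" using less by auto
  obtain d where d: "0 < d" "{x - d<..x} \<subseteq> S i"
    using finite_interval_union_left_nhd feasible_finite_interval_union[OF feas] x(1) by metis
  obtain d' where d': "0 < d'" "{?C j - d'<..?C j} \<subseteq> S j"
    using finite_interval_union_left_nhd feasible_finite_interval_union[OF feas] C_in by metis
  \<comment> \<open>The length of the pieces: the first must lie after the release of \<open>j\<close>, and the second
    after \<open>x\<close>.\<close>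
  define e where "e = min (min d d') (min (x - real (r j)) (?C j - x))"
  have e: "0 < e" "e \<le> d" "e \<le> d'" "e \<le> x - real (r j)" "e \<le> ?C j - x"
    using d d' x by (auto simp: e_def)
  define B where "B = {x - e<..x}"
  define D where "D = {?C j - e<..?C j}"
  have BD: "B \<subseteq> S i" "D \<subseteq> S j" "B \<inter> D = {}"
    using d(2) d'(2) e by (auto simp: B_def D_def subset_iff)
  have disj: "y \<in> S k \<Longrightarrow> y \<in> S l \<Longrightarrow> k = l" for y k l
    using feasible_disjoint[OF feas] by blast
  define S' where "S' = S(i := S i - B \<union> D, j := S j - D \<union> B)"
  have S'i: "S' i = S i - B \<union> D" and S'j: "S' j = S j - D \<union> B"
    and S'k: "\<And>k. k \<noteq> i \<Longrightarrow> k \<noteq> j \<Longrightarrow> S' k = S k"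
    using \<open>i \<noteq> j\<close> by (auto simp: S'_def)
  have fmeas: "S k \<in> fmeasurable lborel" "B \<in> fmeasurable lborel" "D \<in> fmeasurable lborel" for k
    by (auto simp: B_def D_def feasible_fmeasurable[OF feas]
        intro: finite_interval_union_fmeasurable finite_interval_union_Ioc)
  have BD_measure: "measure lborel B = measure lborel D"
    using e(1) by (simp add: B_def D_def)
  have feas': "feasible r p S'"
    unfolding feasible_def is_schedule_def
  proof (intro conjI allI)
    fix k
    have Sk: "finite_interval_union (S k)" "S k \<subseteq> {real (r k)..}"
      "measure lborel (S k) = real (p k)"
      using feas by (auto simp: feasible_def is_schedule_def)
    have cases_k: P if "k = i \<Longrightarrow> P" "k = j \<Longrightarrow> P" "k \<noteq> i \<Longrightarrow> k \<noteq> j \<Longrightarrow> P" for P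
      using that by blast
    show "finite_interval_union (S' k)"
      using feasible_finite_interval_union[OF feas] e(1)
      by (cases rule: cases_k)
        (auto simp: S'i S'j S'k B_def D_def intro!: finite_interval_union_Un
          finite_interval_union_Diff_Ioc finite_interval_union_Ioc)
    have "real (r i) < x"
      using feasible_after_release[OF feas x(1)] .
    then have "D \<subseteq> {real (r i)..}" "B \<subseteq> {real (r j)..}"
      using e by (auto simp: B_def D_def)
    then show "S' k \<subseteq> {real (r k)..}"
      using Sk(2) by (cases rule: cases_k) (auto simp: S'i S'j S'k)
    have "D \<inter> S i = {}" "B \<inter> S j = {}"
      using BD disj \<open>i \<noteq> j\<close> by blast+
    then show "measure lborel (S' k) = real (p k)"
      using Sk(3) BD BD_measure fmeas
      by (cases rule: cases_k) (simp_all add: S'i S'j S'k measure_exchange)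
  next
    have "S' k \<inter> S' l = {}" if "k \<noteq> l" for k l
    proof (rule ccontr)
      assume "S' k \<inter> S' l \<noteq> {}"
      then obtain y where "y \<in> S' k" "y \<in> S' l" by blast
      then show False
        using that BD \<open>i \<noteq> j\<close> disj[of y]
        unfolding S'_def by (auto split: if_splits)
    qed
    then show "disjoint_family S'"
      by (simp add: disjoint_family_on_def)
  qed
  have "completion_time p S' k = ?C k" if "k \<noteq> i" "k \<noteq> j" for k
    using S'k[OF that] by (simp add: completion_time_def processed_def)
  moreover have "completion_time p S' i = ?C i"
  proof (rule completion_time_eqI[OF feas'])
    show "?C i \<in> S' i"
      using C_in[of i] e less x by (auto simp: S'i B_def)
    show "S' i \<subseteq> {..?C i}"
      using C_upper[of i] less by (auto simp: S'i D_def)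
  qed
  moreover have "completion_time p S' j < ?C j"
  proof -
    have "completion_time p S' j \<in> S' j"
      using completion_time_in[OF feas'] pos by blast
    moreover have "S' j \<subseteq> {..<?C j}"
      using C_upper[of j] e x(3) by (force simp: S'j B_def D_def)
    ultimately show ?thesis by blast
  qed
  ultimately have "completion_time p S' k \<le> ?C k" for k
    by (cases "k = i"; cases "k = j") auto
  then have "completion_time p S' < ?C"
    using \<open>completion_time p S' j < ?C j\<close>
    by (auto simp: less_fun_def le_fun_def not_le)
  then show ?thesis
    using that feas' by blast
qed

lemma optimal_priority:
  assumes opt: "optimal r p F S" and pos: "\<forall>j. 0 < p j" and F: "increasing_objective F"
    and x: "x \<in> S i" "real (r j) < x" "x < completion_time p S j"
  shows "completion_time p S i \<le> completion_time p S j"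
proof (rule ccontr)
  assume "\<not> ?thesis"
  moreover have feas: "feasible r p S"
    using opt by (simp add: optimal_def)
  ultimately obtain S' where S': "feasible r p S'" "completion_time p S' < completion_time p S"
    using exchange_improves[OF feas pos x] by force
  have C_pos: "0 < completion_time p R j" if "feasible r p R" for R j
    using feasible_after_release[OF that] completion_time_in[OF that] pos
    by (metis of_nat_0_le_iff order_le_less_trans)
  have "F (completion_time p S') < F (completion_time p S)"
    using F S' C_pos feas
    unfolding increasing_objective_def by (auto elim!: strict_mono_onD)
  then show False
    using opt S'(1) by (force simp: optimal_def)
qed

section \<open>Unit intervals\<close>

text \<open>The horizon is the total amount of work, so that a machine that is busy up to the horizon
  has no work left for later.\<close>

lemma no_idle_within_horizon:
  fixes p :: "'j::finite \<Rightarrow> nat"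
  assumes feas: "feasible r p S" and "no_idle_time p S" and x: "x \<in> S j"
  shows "x \<le> real (horizon p)"
proof (rule ccontr)
  let ?T = "real (horizon p)"
  assume "\<not> x \<le> ?T"
  obtain d where d: "0 < d" "{x - d<..x} \<subseteq> S j"
    using finite_interval_union_left_nhd feasible_finite_interval_union[OF feas] x by metis
  let ?y = "max ?T (x - d)"
  have "{0<..?T} \<union> {?y<..x} \<subseteq> (\<Union>j. S j)"
    using assms(2) d(2) by (force simp: no_idle_time_def)
  then have "measure lborel ({0<..?T} \<union> {?y<..x}) \<le> measure lborel (\<Union>j. S j)"
    by (intro measure_mono_fmeasurable fmeasurable.finite_UN feasible_fmeasurable[OF feas]) auto
  also have "\<dots> = (\<Sum>j\<in>UNIV. measure lborel (S j))"
    using feas feasible_fmeasurable[OF feas, THEN fmeasurableD]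
      feasible_fmeasurable[OF feas, THEN fmeasurableD2]
    by (intro measure_finite_Union) (auto simp: feasible_def is_schedule_def)
  also have "\<dots> = ?T"
    using feas by (simp add: feasible_def horizon_def)
  also have "measure lborel ({0<..?T} \<union> {?y<..x}) = ?T + (x - ?y)"
    using \<open>\<not> x \<le> ?T\<close> d(1)
    by (subst measure_Un3) (auto simp: fmeasurable_def)
  finally show False
    using \<open>\<not> x \<le> ?T\<close> d(1) by simp
qed

text \<open>
  The job that fills \<open>(t, t + 1]\<close> is the first one to complete among those that are available and
  unfinished at time \<open>t\<close>. Since release times are integers, every job that runs during the
  interval is available at its start, so that the priority rule excludes all others until
  this one completes; and it cannot complete strictly inside the interval, because then the
  amount that it still needs at time \<open>t\<close>, an integer, would be less than one unit.
\<close>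

lemma unit_interval_single_job:
  fixes r p :: "'j::finite \<Rightarrow> nat"
  assumes opt: "optimal r p F S" and pos: "\<forall>j. 0 < p j" and F: "increasing_objective F"
    and busy: "no_idle_time p S"
    and t: "t < horizon p" and integral: "\<forall>j. processed S j (real t) \<in> \<int>"
  obtains j where "{real t<..real (Suc t)} \<subseteq> S j"
proof -
  have feas: "feasible r p S"
    using opt by (simp add: optimal_def)
  let ?C = "completion_time p S"
  have C_upper: "x \<le> ?C k" if "x \<in> S k" for x k
    using completion_time_upper[OF feas] pos that by blast
  define Q where "Q = {j. r j \<le> t \<and> real t < ?C j}"
  have runs: "\<exists>k\<in>Q. x \<in> S k" if "x \<in> {real t<..real (Suc t)}" for x
  proof -
    have "x \<in> {0<..real (horizon p)}"
      using that t by auto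
    then obtain k where k: "x \<in> S k"
      using busy by (auto simp: no_idle_time_def)
    have "real (r k) < real (Suc t)"
      using feasible_after_release[OF feas k] that by simp
    then have "r k \<le> t"
      by linarith
    then show ?thesis
      using k that C_upper[OF k] by (auto simp: Q_def)
  qed
  have "Q \<noteq> {}"
    using runs[of "real (Suc t)"] by auto
  then obtain j where j: "j \<in> Q" and min: "\<And>k. k \<in> Q \<Longrightarrow> ?C j \<le> ?C k"
    by (metis finite arg_min_if_finite(1) arg_min_least)
  have runs_j: "x \<in> S j" if x: "real t < x" "x \<le> real (Suc t)" "x \<le> ?C j" for x
  proof -
    obtain k where k: "k \<in> Q" "x \<in> S k"
      using runs x by auto
    have C_j: "?C j \<in> S j"
      using completion_time_in[OF feas] pos by blast
    have "k = j"
    proof (cases "x = ?C j")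
      case True
      then show ?thesis
        using feasible_disjoint[OF feas] k(2) C_j by blast
    next
      case False
      then have "?C k \<le> ?C j"
        using optimal_priority[OF opt pos F k(2), of j] x j by (auto simp: Q_def)
      then have "?C k = ?C j"
        using min[OF k(1)] by simp
      moreover have "?C k \<in> S k"
        using completion_time_in[OF feas] pos by blast
      ultimately show ?thesis
        using feasible_disjoint[OF feas] C_j by metis
    qed
    then show ?thesis
      using k(2) by simp
  qed
  have "real (Suc t) \<le> ?C j"
  proof (rule ccontr)
    assume early: "\<not> ?thesis"
    have "processed S j (?C j) = processed S j (real t) + (?C j - real t)"
      using j early runs_j by (intro processed_while_running[OF feas]) (auto simp: Q_def)
    then have "?C j = real (p j) - processed S j (real t) + real t"
      using processed_at_completion[OF feas] pos by simp
    then have "?C j \<in> \<int>"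
      using integral by simp
    then obtain n where "?C j = of_int n"
      by (elim Ints_cases)
    then have "int t < n" "n < int t + 1"
      using j early by (auto simp: Q_def)
    then show False by simp
  qed
  then show ?thesis
    using that[of j] runs_j by (meson greaterThanAtMost_iff order_trans subsetI)
qed

lemma processed_integral:
  fixes r p :: "'j::finite \<Rightarrow> nat"
  assumes opt: "optimal r p F S" and pos: "\<forall>j. 0 < p j" and F: "increasing_objective F"
    and busy: "no_idle_time p S"
    and "t \<le> horizon p"
  shows "processed S j (real t) \<in> \<int>"
proof -
  have feas: "feasible r p S"
    using opt by (simp add: optimal_def)
  from assms(5) show ?thesis
  proof (induction t arbitrary: j)
    case 0
    have "S j \<inter> {..0} = {}"
      using feasible_after_release[OF feas] by force
    then show ?case
      by (simp add: processed_def)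
  next
    case (Suc t)
    then have IH: "processed S k (real t) \<in> \<int>" for k
      by simp
    obtain k where k: "{real t<..real (Suc t)} \<subseteq> S k"
      using unit_interval_single_job[OF opt pos F busy] Suc.prems IH by (metis Suc_le_lessD)
    have "measure lborel (S j \<inter> {real t<..real (Suc t)}) \<in> \<int>"
    proof (cases "j = k")
      case True
      then have "S j \<inter> {real t<..real (Suc t)} = {real t<..real (Suc t)}"
        using k by auto
      then show ?thesis by simp
    next
      case False
      then have "S j \<inter> {real t<..real (Suc t)} = {}"
        using feasible_disjoint[OF feas] k by blast
      then show ?thesis by simp
    qed
    then show ?case
      using processed_add[OF feas, of "real t" "real (Suc t)" j] IH by simp
  qed
qed

lemma unit_interval_around:
  fixes r p :: "'j::finite \<Rightarrow> nat"
  assumes opt: "optimal r p F S" and pos: "\<forall>j. 0 < p j" and F: "increasing_objective F"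
    and busy: "no_idle_time p S" and x: "x \<in> S j"
  obtains t where "t < horizon p" "real t < x" "x \<le> real (Suc t)"
    "{real t<..real (Suc t)} \<subseteq> S j"
proof -
  have feas: "feasible r p S"
    using opt by (simp add: optimal_def)
  have "0 < x"
    using feasible_after_release[OF feas x] by linarith
  define t where "t = nat (\<lceil>x\<rceil> - 1)"
  have t: "real t < x" "x \<le> real (Suc t)"
    using \<open>0 < x\<close> unfolding t_def by linarith+
  have "t < horizon p"
    using no_idle_within_horizon[OF feas busy x] t(1) by simp
  moreover obtain k where k: "{real t<..real (Suc t)} \<subseteq> S k"
    using unit_interval_single_job[OF opt pos F busy \<open>t < horizon p\<close>]
      processed_integral[OF opt pos F busy] \<open>t < horizon p\<close> by (metis less_imp_le)
  moreover have "k = j"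
    using feasible_disjoint[OF feas _ x] k t by auto
  ultimately show ?thesis
    using that t by blast
qed

section \<open>Job-parts\<close>

theorem corollary1p1:
  fixes r p :: "'j::finite \<Rightarrow> nat"
    and F :: "('j \<Rightarrow> real) \<Rightarrow> real"
  assumes "\<forall>j. 0 < p j"
    and "increasing_objective F"
    and "\<forall>S. optimal r p F S \<longrightarrow> no_idle_time p S"
  shows "\<forall>S. optimal r p F S \<longrightarrow>
           (\<forall>j. \<forall>k\<in>{1..p j}. \<exists>t\<in>{1..horizon p}. job_part S j k \<subseteq> time_interval t)"
proof (intro allI impI ballI)
  fix S j k
  assume opt: "optimal r p F S"
  have feas: "feasible r p S"
    using opt by (simp add: optimal_def)
  have busy: "no_idle_time p S"
    using opt assms(3) by blast
  note block = unit_interval_around[OF opt assms(1,2) busy]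
  have "horizon p \<ge> 1"
    using assms(1) member_le_sum[of j UNIV p]
    by (metis One_nat_def Suc_leI UNIV_I finite horizon_def order_less_le_trans zero_le)
  show "\<exists>t\<in>{1..horizon p}. job_part S j k \<subseteq> time_interval t"
  proof (cases "job_part S j k = {}")
    case True
    then show ?thesis
      using \<open>horizon p \<ge> 1\<close> by (intro bexI[of _ 1]) auto
  next
    case False
    \<comment> \<open>At the start of the unit interval around a point of the job-part, an integer amount
      greater than \<open>k - 2\<close> has been processed; so at least \<open>k - 1\<close> units at its start and \<open>k\<close>
      at its end.\<close>
    have bounds: "real k - 1 \<le> processed S j (real t)" "real k \<le> processed S j (real (Suc t))"
      if x: "x \<in> job_part S j k"
        and t: "t < horizon p" "real t < x" "x \<le> real (Suc t)" "{real t<..real (Suc t)} \<subseteq> S j"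
      for x t
    proof -
      have "processed S j x = processed S j (real t) + (x - real t)"
        using t by (intro processed_while_running[OF feas]) auto
      then have "real k - 2 < processed S j (real t)"
        using x t by (simp add: job_part_def)
      moreover obtain n where n: "processed S j (real t) = of_int n"
        using processed_integral[OF opt assms(1,2) busy, of t j] t(1)
        by (auto elim: Ints_cases)
      ultimately have "int k - 2 < n"
        by linarith
      then show "real k - 1 \<le> processed S j (real t)"
        using n by linarith
      moreover have "processed S j (real (Suc t)) = processed S j (real t) + 1"
        using processed_while_running[OF feas _ t(4)] by simp
      ultimately show "real k \<le> processed S j (real (Suc t))"
        by simp
    qed
    have unique: "y \<le> real (Suc t)"
      if x: "x \<in> job_part S j k" and y: "y \<in> job_part S j k"
        and t: "t < horizon p" "real t < x" "x \<le> real (Suc t)"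
          "{real t<..real (Suc t)} \<subseteq> S j" for x y t
    proof (rule ccontr)
      assume late: "\<not> ?thesis"
      have "y \<in> S j"
        using y by (simp add: job_part_def)
      then obtain s where s: "real s < y" "y \<le> real (Suc s)" "{real s<..real (Suc s)} \<subseteq> S j"
        using block by metis
      have "processed S j y = processed S j (real s) + (y - real s)"
        using s by (intro processed_while_running[OF feas]) auto
      moreover have "real (Suc t) < real (Suc s)"
        using late s(2) by linarith
      then have "real (Suc t) \<le> real s"
        by simp
      then have "processed S j (real (Suc t)) \<le> processed S j (real s)"
        by (rule processed_mono[OF feas])
      ultimately have "real k < processed S j y"
        using bounds(2)[OF x t] s(1) by simp
      then show False
        using y by (simp add: job_part_def)
    qed
    obtain x where x: "x \<in> job_part S j k"
      using False by blast
    then have "x \<in> S j"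
      by (simp add: job_part_def)
    then obtain t where t: "t < horizon p" "real t < x" "x \<le> real (Suc t)"
        "{real t<..real (Suc t)} \<subseteq> S j"
      using block by metis
    have "job_part S j k \<subseteq> time_interval (Suc t)"
    proof
      fix y assume y: "y \<in> job_part S j k"
      then have "y \<in> S j"
        by (simp add: job_part_def)
      then obtain s where s: "s < horizon p" "real s < y" "y \<le> real (Suc s)"
          "{real s<..real (Suc s)} \<subseteq> S j"
        using block by metis
      have "real t < real (Suc s)"
        using unique[OF y x s] t(2) by linarith
      then have "t \<le> s"
        by linarith
      then have "real t < y"
        using s(2) by linarith
      then show "y \<in> time_interval (Suc t)"
        using unique[OF x y t] by (simp add: time_interval_def)
    qed
    then show ?thesis
      using t(1) by (intro bexI[of _ "Suc t"]) auto
  qed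
qed

end
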